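(* Unital associahedra are contractible: for every $n\geq 0$ the space $K^u_n$ is contractible.
   Context: **Trees.** A planted tree with leaves is a finite contractible 1-dimensional simplicial complex $T$ with at least one edge, a distinguished degree-one vertex (the root) and a set of distinguished degree-one vertices different from the root (the leaves). The remaining degree-one vertices are called corks. It is planar if its vertex set carries a total order $\preceq$ (path order) such that: if $v\neq w$ lies on the shortest path from the root to $w$ then $v\prec w$; otherwise, if neither lies on the path to the other, the paths to $v$ and $w$ agree up to level $n$ (level = distance to the root), and $v',w'$ are the level $n+1$ vertices on these paths, then $v'\prec w'$ implies $v\prec w$. "Tree" means planted planar tree with leaves, up to isomorphism preserving root, leaves and path order. Edges are ordered by their top vertices (the vertex farther from the root). A vertex is inner if it is neither the root nor a leaf; an edge is inner if both its vertices are inner. The tree $|$ has one edge, joining the root to a single leaf. For an inner edge $e$, $T/e$ is the tree obtained by contracting $e$. A tree is binary if all vertices have degree 1 or 3. A binary tree different from $|$ with $n$ leaves and $m$ corks has $2m+n-2$ inner edges. If $T$ is binary and $e=\{u\prec v\}$ is an edge with $u$ of degree 3 and $v$ of degree 1, $T\backslash e$ is the binary tree obtained by removing $v$ and $e$ and deleting $u$, so that the other two edges at $u$ are joined into one edge. **Unital associahedra.** $\partial_i^-\colon[0,1]^{k-1}\to[0,1]^k$ inserts $0$ as the new $i$-th coordinate. For a binary tree $T$ with $n$ leaves and $m$ corks let $H_T=[0,1]^{2m+n-2}$ (with $H_|=\bullet$ a point); a point $(x_1,x_2,\dots)\in H_T$ is regarded as the labelling of the $i$-th inner edge of $T$ by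 $x_i$ for all $i$. The unital associahedron $K^u_n$ is the cell complex which is the quotient of $\coprod_T H_T$ ($T$ running over all binary trees with $n$ leaves and any number of corks) by the equivalence relation generated by: (R1) If $T,T'$ are binary trees with $n$ leaves and $m$ corks, the $i$-th inner edge $e_i$ of $T$ and the $j$-th inner edge $e'_j$ of $T'$ do not contain corks, and $T/e_i=T'/e'_j$, then $\partial_i^-(x)\in H_T$ is identified with $\partial_j^-(x)\in H_{T'}$ for all $x\in[0,1]^{2m+n-3}$. (R2) If the $i$-th inner edge $e_i$ of $T$ contains a cork, then $\partial_i^-(x)\in H_T$ is identified with $\varepsilon(x)\in H_{T\backslash e_i}$ for all $x\in[0,1]^{2m+n-3}$, where $\varepsilon$ is the following map. Let $u$ be the degree 3 vertex of $e_i$ and let $e',e''$ be the other two edges at $u$, which become a single edge $\bar e$ of $T\backslash e_i$. The point $x$ gives labels to all inner edges of $T$ other than $e_i$; $\varepsilon(x)$ keeps the labels of all inner edges different from $e',e''$. If $e'$ and $e''$ are both inner with labels $a,b$, then $\bar e$ is inner and gets the label $\max(a,b)$; if exactly one of $e',e''$ is inner, then $\bar e$ is not inner and that label is forgotten; if neither is inner, then $T\backslash e_i=|$ and $\varepsilon(x)=\bullet\in H_|$. *)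

theory Defs
  imports "HOL-Analysis.Analysis"
begin

section \<open>Planted planar trees with leaves\<close>

text \<open>
  An element of this type is an isomorphism class of planted planar trees with leaves.  The root
  and its unique edge are left implicit: the term describes what lies above the root edge.  A
  vertex different from the root is a leaf or has a (possibly empty) list of children, given in
  path order; a vertex \<open>Node []\<close> has degree one without being a leaf, so it is a cork.
\<close>

datatype ptree = is_leaf: Leaf | Node (children: "ptree list")
  where "children Leaf = []"

text \<open>
  Non-root vertices are addressed by the list of child numbers (from 0) met on the way up from the
  lowest non-root vertex \<open>[]\<close>.  The level of the vertex \<open>p\<close> is \<open>length p + 1\<close>.  As every edge has
  exactly one top vertex, the same addresses denote the edges: \<open>p\<close> stands for the edge whose top
  vertex is \<open>p\<close>.  The address \<open>[]\<close> is thus the root edge, and for \<open>p \<noteq> []\<close> the bottom vertex of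
  the edge \<open>p\<close> is \<open>butlast p\<close>.
\<close>

fun subtree :: "ptree \<Rightarrow> nat list \<Rightarrow> ptree" where
  "subtree T [] = T"
| "subtree T (i # p) = subtree (children T ! i) p"

fun replace_subtree :: "ptree \<Rightarrow> nat list \<Rightarrow> ptree \<Rightarrow> ptree" where
  "replace_subtree T [] S = S"
| "replace_subtree T (i # p) S =
     Node ((children T)[i := replace_subtree (children T ! i) p S])"

text \<open>
  The non-root vertices, listed in path order, which on addresses is the lexicographic order with
  prefixes first (see \<open>sorted_vertices\<close> below).
\<close>

primrec vertices :: "ptree \<Rightarrow> nat list list" where
  "vertices Leaf = [[]]"
| "vertices (Node ts) =
     [] # concat (map2 (\<lambda>i. map ((#) i)) [0..<length ts] (map vertices ts))"

fun num_leaves :: "ptree \<Rightarrow> nat" where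
  "num_leaves Leaf = 1"
| "num_leaves (Node ts) = (\<Sum>t\<leftarrow>ts. num_leaves t)"

fun num_corks :: "ptree \<Rightarrow> nat" where
  "num_corks Leaf = 0"
| "num_corks (Node ts) = (if ts = [] then 1 else \<Sum>t\<leftarrow>ts. num_corks t)"

text \<open>A vertex \<open>Node ts\<close> has degree \<open>length ts + 1\<close>; the root and the leaves have degree one.\<close>

fun is_binary :: "ptree \<Rightarrow> bool" where
  "is_binary Leaf \<longleftrightarrow> True"
| "is_binary (Node ts) \<longleftrightarrow> length ts + 1 \<in> {1, 3} \<and> (\<forall>t \<in> set ts. is_binary t)"

text \<open>
  The root is an end point of the edge \<open>[]\<close> only, and the bottom vertex of an edge is never a leaf.
  Hence the inner edges, those joining two vertices that are neither the root nor a leaf, are the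
  edges other than \<open>[]\<close> whose top vertex is not a leaf.  They are listed in path order of their
  top vertices.
\<close>

definition inner_edges :: "ptree \<Rightarrow> nat list list" where
  "inner_edges T = filter (\<lambda>p. p \<noteq> [] \<and> subtree T p \<noteq> Leaf) (vertices T)"

text \<open>The bottom vertex of an inner edge has degree at least two, so only its top can be a cork.\<close>

definition contains_cork :: "ptree \<Rightarrow> nat list \<Rightarrow> bool" where
  "contains_cork T e \<longleftrightarrow> subtree T e = Node []"

text \<open>\<open>T/e\<close>: the children of the top vertex of \<open>e\<close> take its place among the children of the bottom
  vertex.\<close>

definition contract :: "ptree \<Rightarrow> nat list \<Rightarrow> ptree" where
  "contract T e =
    (let u = butlast e; c = last e; ts = children (subtree T u)
     in replace_subtree T u (Node (take c ts @ children (ts ! c) @ drop (Suc c) ts)))"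

text \<open>
  Let \<open>e\<close> be an edge of a binary tree with bottom vertex \<open>u = butlast e\<close> of degree three.  Of the two
  other edges at \<open>u\<close>, the lower one is the edge \<open>u\<close> and the upper one is \<open>sibling e\<close>.  If the
  top vertex of \<open>e\<close> has degree one, then \<open>T\<setminus>e\<close> arises by putting the subtree at \<open>sibling e\<close>
  in place of the subtree at \<open>u\<close>; the edge of \<open>T\<setminus>e\<close> that joins the two again has address \<open>u\<close>.
\<close>

definition sibling :: "nat list \<Rightarrow> nat list" where
  "sibling e = butlast e @ [1 - last e]"

definition delete_edge :: "ptree \<Rightarrow> nat list \<Rightarrow> ptree" where
  "delete_edge T e = replace_subtree T (butlast e) (subtree T (sibling e))"

text \<open>The edge of \<open>T\<close> corresponding to the edge \<open>f \<noteq> butlast e\<close> of \<open>T\<setminus>e\<close>.\<close>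

definition old_edge :: "nat list \<Rightarrow> nat list \<Rightarrow> nat list" where
  "old_edge e f =
    (let u = butlast e in
     if take (length u) f = u then sibling e @ drop (length u) f else f)"


section \<open>Cubes and labellings\<close>

text \<open>Coordinates are numbered from 0.\<close>

definition cube :: "nat \<Rightarrow> (nat \<Rightarrow> real) topology" where
  "cube k = product_topology (\<lambda>_. top_of_set {0..1}) {..<k}"

definition face0 :: "nat \<Rightarrow> (nat \<Rightarrow> real) \<Rightarrow> (nat \<Rightarrow> real)" where
  "face0 i x = (\<lambda>k. if k < i then x k else if k = i then 0 else x (k - 1))"

text \<open>For the tree \<open>Leaf\<close> the truncated subtraction gives 0, and \<open>H_cell Leaf\<close> is a point as required.\<close>

definition H_cell :: "ptree \<Rightarrow> (nat \<Rightarrow> real) topology" where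
  "H_cell T = cube (2 * num_corks T + num_leaves T - 2)"

text \<open>The label of \<open>e\<close> if the distinct edges \<open>es\<close> are labelled in turn by the coordinates of \<open>x\<close>.\<close>

definition label :: "nat list list \<Rightarrow> (nat \<Rightarrow> real) \<Rightarrow> nat list \<Rightarrow> real" where
  "label es x e = x (THE j. j < length es \<and> es ! j = e)"

text \<open>
  The map \<open>\<epsilon>\<close> into \<open>H_cell (T\<setminus>e)\<close>.  The joined edge \<open>u\<close> of \<open>T\<setminus>e\<close> is inner iff both \<open>u\<close> and \<open>sibling e\<close>
  are inner in \<open>T\<close>; otherwise it is not in the list \<open>fs\<close>, and the label of an inner one among \<open>u\<close>
  and \<open>sibling e\<close> is dropped.
\<close>

definition cork_map :: "ptree \<Rightarrow> nat list \<Rightarrow> (nat \<Rightarrow> real) \<Rightarrow> (nat \<Rightarrow> real)" where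
  "cork_map T e x =
    (let u = butlast e;
         lab = label (remove1 e (inner_edges T)) x;
         fs = inner_edges (delete_edge T e)
     in (\<lambda>j\<in>{..<length fs}.
          if fs ! j = u then max (lab u) (lab (sibling e)) else lab (old_edge e (fs ! j))))"


section \<open>Unital associahedra\<close>

definition quotient_topology :: "'a topology \<Rightarrow> ('a \<times> 'a) set \<Rightarrow> 'a set topology" where
  "quotient_topology X R = topology (\<lambda>U. U \<subseteq> topspace X // R \<and> openin X (\<Union>U))"

definition binary_trees :: "nat \<Rightarrow> ptree set" where
  "binary_trees n = {T. is_binary T \<and> num_leaves T = n}"

inductive glue :: "nat \<Rightarrow> ptree \<times> (nat \<Rightarrow> real) \<Rightarrow> ptree \<times> (nat \<Rightarrow> real) \<Rightarrow> bool"
  for n :: nat where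
  R1: "\<lbrakk>T \<in> binary_trees n; T' \<in> binary_trees n; num_corks T = m; num_corks T' = m;
        i < length (inner_edges T); j < length (inner_edges T');
        \<not> contains_cork T (inner_edges T ! i); \<not> contains_cork T' (inner_edges T' ! j);
        contract T (inner_edges T ! i) = contract T' (inner_edges T' ! j);
        x \<in> topspace (cube (2 * m + n - 3))\<rbrakk>
       \<Longrightarrow> glue n (T, face0 i x) (T', face0 j x)"
| R2: "\<lbrakk>T \<in> binary_trees n; num_corks T = m;
        i < length (inner_edges T); contains_cork T (inner_edges T ! i);
        x \<in> topspace (cube (2 * m + n - 3))\<rbrakk>
       \<Longrightarrow> glue n (T, face0 i x)
                  (delete_edge T (inner_edges T ! i), cork_map T (inner_edges T ! i) x)"

definition cells :: "nat \<Rightarrow> (ptree \<times> (nat \<Rightarrow> real)) topology" where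
  "cells n = sum_topology H_cell (binary_trees n)"

definition glue_equiv :: "nat \<Rightarrow> ((ptree \<times> (nat \<Rightarrow> real)) \<times> (ptree \<times> (nat \<Rightarrow> real))) set" where
  "glue_equiv n =
     {(a, b). a \<in> topspace (cells n) \<and> b \<in> topspace (cells n) \<and> equivclp (glue n) a b}"

definition unital_associahedron :: "nat \<Rightarrow> (ptree \<times> (nat \<Rightarrow> real)) set topology" where
  "unital_associahedron n = quotient_topology (cells n) (glue_equiv n)"


section \<open>Basic properties of the definitions\<close>

lemma sorted_wrt_concat_map:
  assumes "\<And>i. i < n \<Longrightarrow> sorted_wrt R (f i)"
    and "\<And>i j x y. i < j \<Longrightarrow> j < n \<Longrightarrow> x \<in> set (f i) \<Longrightarrow> y \<in> set (f j) \<Longrightarrow> R x y"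
  shows "sorted_wrt R (concat (map f [0..<n]))"
  using assms by (induction n) (auto simp: sorted_wrt_append)

lemma vertices_Node:
  "vertices (Node ts) = [] # concat (map (\<lambda>i. map ((#) i) (vertices (ts ! i))) [0..<length ts])"
  by simp (rule arg_cong[of _ _ concat], rule nth_equalityI, auto)

lemma sorted_vertices:
  "sorted_wrt (\<lambda>p q. (p, q) \<in> lexord {(i, j). i < j}) (vertices T)"
proof (induction T)
  case (Node ts)
  have "sorted_wrt (\<lambda>p q. (p, q) \<in> lexord {(i, j). i < j})
     (concat (map (\<lambda>i. map ((#) i) (vertices (ts ! i))) [0..<length ts]))"
    by (rule sorted_wrt_concat_map) (use Node in \<open>auto simp: sorted_wrt_map\<close>)
  then show ?case by (auto simp: vertices_Node simp del: vertices.simps)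
qed simp

lemma distinct_vertices: "distinct (vertices T)"
proof -
  have "(p, p) \<notin> lexord {(i, j). i < j}" for p :: "nat list"
    by (rule lexord_irreflexive) auto
  then have "sorted_wrt (\<noteq>) (vertices T)"
    by (intro sorted_wrt_mono_rel[OF _ sorted_vertices]) auto
  then show ?thesis by (simp add: distinct_conv_nth sorted_wrt_iff_nth_less) (metis linorder_neqE_nat)
qed

lemma num_inner_edges:
  assumes "is_binary T"
  shows "length (inner_edges T) = 2 * num_corks T + num_leaves T - 2"
proof -
  have *: "length (filter (\<lambda>p. subtree T p \<noteq> Leaf) (vertices T)) + 1
      = 2 * num_corks T + num_leaves T"
    using assms
  proof (induction T)
    case (Node ts)
    from Node.prems consider "ts = []" | a b where "ts = [a, b]"
      by (auto simp: length_Suc_conv numeral_3_eq_3)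
    then show ?case
    proof cases
      case 2
      then show ?thesis using Node.IH[of a] Node.IH[of b] Node.prems
        by (simp add: filter_map comp_def upt_rec)
    qed simp
  qed simp
  obtain vs where vs: "vertices T = [] # vs" by (cases T) auto
  with distinct_vertices[of T] have "filter (\<lambda>p. p \<noteq> [] \<and> Q p) vs = filter Q vs" for Q
    by (intro filter_cong) auto
  then show ?thesis using * vs by (cases T) (auto simp: inner_edges_def)
qed

lemma openin_quotient_topology:
  assumes "equiv (topspace X) R"
  shows "openin (quotient_topology X R) U \<longleftrightarrow> U \<subseteq> topspace X // R \<and> openin X (\<Union>U)"
proof -
  have "istopology (\<lambda>U. U \<subseteq> topspace X // R \<and> openin X (\<Union>U))" (is "istopology ?L")
    unfolding istopology_def
  proof (intro conjI allI impI)
    fix S T assume S: "?L S" and T: "?L T"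
    have "\<Union>(S \<inter> T) = \<Union>S \<inter> \<Union>T"
    proof
      show "\<Union>S \<inter> \<Union>T \<subseteq> \<Union>(S \<inter> T)"
        using quotient_disj [OF assms] S T by blast
    qed auto
    then show "S \<inter> T \<subseteq> topspace X // R" "openin X (\<Union>(S \<inter> T))"
      using S T by auto
  next
    fix K assume K: "\<forall>S\<in>K. ?L S"
    then show "\<Union>K \<subseteq> topspace X // R" by blast
    have "\<Union>(\<Union>K) = \<Union>(Union ` K)" by blast
    then show "openin X (\<Union>(\<Union>K))" using K by auto
  qed
  then show ?thesis by (simp add: quotient_topology_def)
qed

lemma topspace_quotient_topology:
  assumes "equiv (topspace X) R"
  shows "topspace (quotient_topology X R) = topspace X // R"
proof -
  have "openin (quotient_topology X R) (topspace X // R)"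
    by (simp add: openin_quotient_topology [OF assms] Union_quotient [OF assms])
  moreover have "topspace (quotient_topology X R) \<subseteq> topspace X // R"
    using openin_topspace [of "quotient_topology X R"] openin_quotient_topology [OF assms] by blast
  ultimately show ?thesis
    by (simp add: openin_subset subset_antisym)
qed

lemma quotient_map_quotient_topology:
  assumes "equiv (topspace X) R"
  shows "quotient_map X (quotient_topology X R) (\<lambda>x. R `` {x})"
  unfolding quotient_map_def topspace_quotient_topology [OF assms]
proof (intro conjI allI impI)
  show "(\<lambda>x. R `` {x}) ` topspace X = topspace X // R"
    by (auto simp: quotient_def)
  fix U assume U: "U \<subseteq> topspace X // R"
  have "{x \<in> topspace X. R `` {x} \<in> U} = \<Union>U"
  proof (intro equalityI subsetI)
    fix x assume "x \<in> {x \<in> topspace X. R `` {x} \<in> U}"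
    then show "x \<in> \<Union>U" using equiv_class_self [OF assms] by blast
  next
    fix x assume "x \<in> \<Union>U"
    then obtain C where C: "C \<in> U" "x \<in> C" by blast
    then obtain y where "y \<in> topspace X" "C = R `` {y}"
      using U by (auto simp: quotient_def)
    then show "x \<in> {x \<in> topspace X. R `` {x} \<in> U}"
      using C equiv_class_eq_iff [OF assms, of y x] by auto
  qed
  then show "openin X {x \<in> topspace X. R `` {x} \<in> U} \<longleftrightarrow> openin (quotient_topology X R) U"
    using U by (simp add: openin_quotient_topology [OF assms])
qed

lemma equiv_glue_equiv: "equiv (topspace (cells n)) (glue_equiv n)"
proof (rule equivI)
  show "glue_equiv n \<subseteq> topspace (cells n) \<times> topspace (cells n)"
    by (auto simp: glue_equiv_def)
  show "refl_on (topspace (cells n)) (glue_equiv n)"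
    by (auto simp: glue_equiv_def refl_on_def)
  show "sym (glue_equiv n)"
    unfolding glue_equiv_def sym_def using equivclp_sym by fast
  show "trans (glue_equiv n)"
    unfolding glue_equiv_def trans_def using equivclp_trans by fast
qed

end

theory Submission
  imports Defs
begin

text \<open>
  A point of the space is a binary tree whose inner edges have lengths in \<open>[0,1]\<close>.  Multiplying
  all lengths by the same \<open>t \<in> [0,1]\<close> respects both kinds of identification: an edge of length 0
  keeps length 0, and \<open>max (t * a) (t * b) = t * max a b\<close> takes care of the two edges that are
  joined when a cork is removed (\<open>cork_map_scale_labels\<close>, \<open>glue_scale_cell\<close>).  So the scaling
  descends to the quotient, and there it is jointly continuous in \<open>t\<close> and the point, because the
  product of a quotient map with the locally compact Hausdorff space \<open>[0,1]\<close> is again a quotient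
  map.  This is a homotopy from the identity, at \<open>t = 1\<close>, to the map at \<open>t = 0\<close>, which sends a
  point in the cell of \<open>T\<close> to the class of the origin of that cell.

  It remains to see that the origins of all cells represent the same point.  When all lengths are 0,
  the first identification moves a bracket, turning \<open>(ab)c\<close> into \<open>a(bc)\<close>, and the second cancels
  a cork, turning \<open>1b\<close> or \<open>b1\<close> into \<open>b\<close>; both may be applied inside a larger tree
  (\<open>move_glue_origin\<close>).  By these associativity and unit laws every binary tree can be brought to
  a normal form that depends on its number of leaves only (\<open>equivclp_move_comb\<close>).
\<close>

section \<open>Edges of a tree\<close>

text \<open>Membership in \<open>vertices\<close> is decided below by recursion on the address; unfolding the list
  itself would hide the addresses behind \<open>zip\<close>.\<close>

declare vertices.simps(2) [simp del]

definition nonleaf_vertices :: "ptree \<Rightarrow> nat list set" where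
  "nonleaf_vertices T = {p \<in> set (vertices T). subtree T p \<noteq> Leaf}"

lemma set_inner_edges: "set (inner_edges T) = nonleaf_vertices T - {[]}"
  by (auto simp: inner_edges_def nonleaf_vertices_def)

lemma distinct_inner_edges: "distinct (inner_edges T)"
  by (simp add: inner_edges_def distinct_vertices)

lemma Nil_in_vertices [simp]: "[] \<in> set (vertices T)"
  by (cases T) (auto simp: vertices_Node)

lemma Cons_in_vertices [simp]:
  "i # p \<in> set (vertices T) \<longleftrightarrow> i < length (children T) \<and> p \<in> set (vertices (children T ! i))"
  by (cases T) (auto simp: vertices_Node)

lemma append_in_vertices:
  "p @ q \<in> set (vertices T) \<longleftrightarrow> p \<in> set (vertices T) \<and> q \<in> set (vertices (subtree T p))"
  by (induction p arbitrary: T) auto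

lemma subtree_append: "subtree T (p @ q) = subtree (subtree T p) q"
  by (induction p arbitrary: T) auto

lemma Nil_in_nonleaf_vertices [simp]: "[] \<in> nonleaf_vertices T \<longleftrightarrow> T \<noteq> Leaf"
  by (simp add: nonleaf_vertices_def)

lemma Cons_in_nonleaf_vertices [simp]:
  "i # p \<in> nonleaf_vertices T \<longleftrightarrow>
     i < length (children T) \<and> p \<in> nonleaf_vertices (children T ! i)"
  by (auto simp: nonleaf_vertices_def)

lemma append_in_nonleaf_vertices:
  "p @ q \<in> nonleaf_vertices T \<longleftrightarrow> p \<in> set (vertices T) \<and> q \<in> nonleaf_vertices (subtree T p)"
  by (auto simp: nonleaf_vertices_def append_in_vertices subtree_append)

text \<open>
  The non-leaves are considered instead of all vertices because they are what inner edges are made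
  of.  The addresses strictly below \<open>u\<close> fall under the second case: there the two trees have
  different subtrees in general, but neither of them is a leaf.
\<close>

lemma nonleaf_vertices_replace_subtree:
  assumes "u \<in> set (vertices T)"
  shows "f \<in> nonleaf_vertices (replace_subtree T u S) \<longleftrightarrow>
    (if take (length u) f = u then drop (length u) f \<in> nonleaf_vertices S
     else f \<in> nonleaf_vertices T)"
  using assms
proof (induction u arbitrary: T f)
  case (Cons i u)
  show ?case
  proof (cases f)
    case Nil
    with Cons.prems show ?thesis by auto
  next
    case (Cons k g)
    with Cons.prems Cons.IH[of "children T ! i" g] show ?thesis
      by (cases "k = i") auto
  qed
qed simp

lemma is_binary_subtree: "is_binary T \<Longrightarrow> p \<in> set (vertices T) \<Longrightarrow> is_binary (subtree T p)"
proof (induction p arbitrary: T)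
  case (Cons i p)
  then show ?case by (cases T) auto
qed simp

lemma binary_edge_cases:
  assumes "is_binary T" "e \<in> set (inner_edges T)"
  obtains u c where "e = u @ [c]" "u \<in> set (vertices T)"
    "length (children (subtree T u)) = 2"
proof -
  from assms(2) have "e \<noteq> []" "e \<in> set (vertices T)"
    by (auto simp: inner_edges_def)
  then obtain u c where e: "e = u @ [c]" by (metis rev_exhaust)
  with \<open>e \<in> set (vertices T)\<close> have u: "u \<in> set (vertices T)" "c < length (children (subtree T u))"
    by (auto simp: append_in_vertices)
  moreover have "is_binary (subtree T u)" using assms(1) u(1) by (rule is_binary_subtree)
  ultimately have "length (children (subtree T u)) = 2"
    by (cases "subtree T u") auto
  with e u that show thesis by simp
qed

text \<open>
  The next two lemmas say that \<open>cork_map\<close> reads only coordinates of inner edges of \<open>T\<close> other than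
  \<open>e\<close>.  Outside these edges \<open>label\<close> is an unspecified value, which scaling need not respect.
\<close>

lemma joined_edge_inner:
  assumes "is_binary T" "e \<in> set (inner_edges T)"
    and "butlast e \<in> set (inner_edges (delete_edge T e))"
  shows "butlast e \<in> set (remove1 e (inner_edges T))"
    "sibling e \<in> set (remove1 e (inner_edges T))"
proof -
  obtain u c where e: "e = u @ [c]" "u \<in> set (vertices T)"
    "length (children (subtree T u)) = 2"
    using binary_edge_cases[OF assms(1,2)] .
  have "subtree T u \<noteq> Leaf" using e(3) by auto
  with e have "u \<in> nonleaf_vertices T" by (simp add: nonleaf_vertices_def)
  with assms(3) e have "u \<in> set (inner_edges T)" "subtree T (sibling e) \<noteq> Leaf"
    by (auto simp: set_inner_edges delete_edge_def nonleaf_vertices_replace_subtree)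
  moreover from this e have "sibling e \<in> set (inner_edges T)"
    by (auto simp: set_inner_edges sibling_def append_in_nonleaf_vertices subtree_append)
  moreover have "1 - c \<noteq> c" by (cases c) auto
  ultimately show "butlast e \<in> set (remove1 e (inner_edges T))"
    "sibling e \<in> set (remove1 e (inner_edges T))"
    using e by (auto simp: sibling_def distinct_inner_edges)
qed

lemma old_edge_inner:
  assumes "is_binary T" "e \<in> set (inner_edges T)"
    and "f \<in> set (inner_edges (delete_edge T e))" "f \<noteq> butlast e"
  shows "old_edge e f \<in> set (remove1 e (inner_edges T))"
proof -
  obtain u c where e: "e = u @ [c]" "u \<in> set (vertices T)"
    "length (children (subtree T u)) = 2"
    using binary_edge_cases[OF assms(1,2)] .
  show ?thesis
  proof (cases "take (length u) f = u")
    case True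
    with assms(4) e have "drop (length u) f \<noteq> []"
      by (metis append.right_neutral append_take_drop_id butlast_snoc)
    moreover have "sibling e \<in> set (vertices T)"
      using e by (auto simp: sibling_def append_in_vertices)
    ultimately show ?thesis using assms(3) e True
      by (auto simp: set_inner_edges delete_edge_def nonleaf_vertices_replace_subtree
          old_edge_def append_in_nonleaf_vertices distinct_inner_edges sibling_def
          subtree_append)
  next
    case False
    with assms(3) e show ?thesis
      by (auto simp: set_inner_edges delete_edge_def nonleaf_vertices_replace_subtree
          old_edge_def distinct_inner_edges)
  qed
qed

section \<open>Scaling the labels\<close>

text \<open>The points of \<open>cube d\<close> are undefined outside \<open>{..<d}\<close>, so the dimension is a parameter.\<close>

definition scale_labels :: "nat \<Rightarrow> real \<Rightarrow> (nat \<Rightarrow> real) \<Rightarrow> (nat \<Rightarrow> real)" where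
  "scale_labels d t x = (\<lambda>k\<in>{..<d}. t * x k)"

lemma topspace_cube: "topspace (cube d) = (\<Pi>\<^sub>E k\<in>{..<d}. {0..1})"
  by (simp add: cube_def)

lemma scale_labels_in_cube: "x \<in> topspace (cube d) \<Longrightarrow> t \<in> {0..1} \<Longrightarrow> scale_labels d t x \<in> topspace (cube d)"
  by (auto simp: topspace_cube scale_labels_def PiE_iff mult_le_one)

lemma scale_labels_1: "x \<in> topspace (cube d) \<Longrightarrow> scale_labels d 1 x = x"
  by (auto simp: topspace_cube scale_labels_def PiE_iff extensional_def fun_eq_iff)

lemma scale_labels_face0:
  assumes "i < d"
  shows "scale_labels d t (face0 i x) = face0 i (scale_labels (d - 1) t x)"
  using assms by (auto simp: scale_labels_def face0_def fun_eq_iff)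

lemma label_scale_labels:
  assumes "e \<in> set es" "distinct es"
  shows "label es (scale_labels (length es) t x) e = t * label es x e"
proof -
  from assms(1) obtain j where j: "j < length es" "es ! j = e" by (auto simp: in_set_conv_nth)
  with assms(2) have "(THE j. j < length es \<and> es ! j = e) = j"
    by (intro the_equality) (auto simp: nth_eq_iff_index_eq)
  with j show ?thesis by (simp add: label_def scale_labels_def)
qed

text \<open>The map \<open>\<epsilon>\<close> forgets some labels, keeps others and takes one maximum, and \<open>max\<close> commutes with
  multiplication by a nonnegative number.\<close>

lemma cork_map_scale_labels:
  assumes "is_binary T" "e \<in> set (inner_edges T)" "t \<ge> 0"
  shows "cork_map T e (scale_labels (length (inner_edges T) - 1) t x) =
    scale_labels (length (inner_edges (delete_edge T e))) t (cork_map T e x)"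
proof -
  define es where "es = remove1 e (inner_edges T)"
  define fs where "fs = inner_edges (delete_edge T e)"
  define x' where "x' = scale_labels (length es) t x"
  have len: "length es = length (inner_edges T) - 1"
    using assms(2) by (simp add: es_def length_remove1)
  have lab: "label es x' f = t * label es x f" if "f \<in> set es" for f
    using that by (simp add: x'_def es_def label_scale_labels distinct_inner_edges)
  have "cork_map T e x' j = scale_labels (length fs) t (cork_map T e x) j" for j
  proof (cases "j < length fs")
    case True
    then have f: "fs ! j \<in> set (inner_edges (delete_edge T e))" by (simp add: fs_def)
    show ?thesis
    proof (cases "fs ! j = butlast e")
      case eq: True
      then show ?thesis using True joined_edge_inner[OF assms(1,2)] f assms(3)
        by (simp add: cork_map_def Let_def scale_labels_def lab max_mult_distrib_left flip: es_def fs_def)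
    next
      case False
      then show ?thesis using True old_edge_inner[OF assms(1,2) f]
        by (simp add: cork_map_def Let_def scale_labels_def lab flip: es_def fs_def)
    qed
  qed (simp add: cork_map_def Let_def scale_labels_def flip: fs_def)
  then show ?thesis by (auto simp: x'_def len fs_def)
qed

definition scale_cell :: "real \<Rightarrow> ptree \<times> (nat \<Rightarrow> real) \<Rightarrow> ptree \<times> (nat \<Rightarrow> real)" where
  "scale_cell t = (\<lambda>(T, x). (T, scale_labels (length (inner_edges T)) t x))"

lemma glue_scale_cell:
  assumes "glue n a b" "t \<in> {0..1}"
  shows "glue n (scale_cell t a) (scale_cell t b)"
  using assms(1)
proof cases
  case (R1 T T' m i j x)
  then have l: "length (inner_edges T) = 2 * m + n - 2" "length (inner_edges T') = 2 * m + n - 2"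
    by (auto simp: num_inner_edges binary_trees_def)
  have d: "2 * m + n - 2 - 1 = 2 * m + n - 3" by simp
  have "glue n (T, face0 i (scale_labels (2 * m + n - 3) t x)) (T', face0 j (scale_labels (2 * m + n - 3) t x))"
    using R1 assms(2) scale_labels_in_cube[of x "2 * m + n - 3" t] by (intro glue.R1) auto
  then show ?thesis
    using R1 l scale_labels_face0[of _ "2 * m + n - 2", unfolded d]
    by (simp add: scale_cell_def)
next
  case (R2 T m i x)
  then have l: "length (inner_edges T) = 2 * m + n - 2" and T: "is_binary T"
    by (auto simp: num_inner_edges binary_trees_def)
  have d: "2 * m + n - 2 - 1 = 2 * m + n - 3" by simp
  let ?y = "scale_labels (2 * m + n - 3) t x"
  let ?e = "inner_edges T ! i"
  have "glue n (T, face0 i ?y) (delete_edge T ?e, cork_map T ?e ?y)"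
    using R2 assms(2) scale_labels_in_cube[of x "2 * m + n - 3" t] by (intro glue.R2) auto
  then show ?thesis
    using R2 l T assms(2) scale_labels_face0[of _ "2 * m + n - 2", unfolded d]
      cork_map_scale_labels[of T ?e t x]
    by (simp add: scale_cell_def)
qed

lemma equivclp_map:
  assumes "equivclp r a b" "\<And>a b. r a b \<Longrightarrow> equivclp s (f a) (f b)"
  shows "equivclp s (f a) (f b)"
  using assms(1)
proof (induction rule: equivclp_induct)
  case (step y z)
  then have "equivclp s (f y) (f z)" using assms(2) equivclp_sym by metis
  with step.IH show ?case by (rule equivclp_trans)
qed simp

lemma mem_cells:
  "(T, x) \<in> topspace (cells n) \<longleftrightarrow>
     T \<in> binary_trees n \<and> x \<in> topspace (cube (length (inner_edges T)))"
proof -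
  have "H_cell T = cube (length (inner_edges T))" if "T \<in> binary_trees n"
    using that by (simp add: H_cell_def binary_trees_def num_inner_edges)
  then show ?thesis by (auto simp: cells_def)
qed

lemma scale_cell_in_cells:
  "a \<in> topspace (cells n) \<Longrightarrow> t \<in> {0..1} \<Longrightarrow> scale_cell t a \<in> topspace (cells n)"
  by (cases a) (simp add: scale_cell_def mem_cells scale_labels_in_cube)

lemma scale_cell_1: "a \<in> topspace (cells n) \<Longrightarrow> scale_cell 1 a = a"
  by (cases a) (simp add: scale_cell_def mem_cells scale_labels_1)

lemma glue_equiv_scale_cell:
  assumes "(a, b) \<in> glue_equiv n" "t \<in> {0..1}"
  shows "(scale_cell t a, scale_cell t b) \<in> glue_equiv n"
proof -
  have "equivclp (glue n) a b" using assms(1) by (simp add: glue_equiv_def)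
  then have "equivclp (glue n) (scale_cell t a) (scale_cell t b)"
    by (rule equivclp_map) (rule r_into_equivclp, erule glue_scale_cell[OF _ assms(2)])
  then show ?thesis using assms by (simp add: glue_equiv_def scale_cell_in_cells)
qed

text \<open>Each summand is open in the sum, so continuity can be tested on the summands even after taking
  the product with another space.\<close>

lemma continuous_map_prod_sum_topology:
  assumes "\<And>i. i \<in> I \<Longrightarrow> continuous_map (prod_topology Z (X i)) Y (\<lambda>(z, x). f (z, (i, x)))"
  shows "continuous_map (prod_topology Z (sum_topology X I)) Y f"
  unfolding continuous_map_def
proof (intro conjI allI impI)
  show "f \<in> topspace (prod_topology Z (sum_topology X I)) \<rightarrow> topspace Y"
    using continuous_map_image_subset_topspace[OF assms] by fastforce
  fix U assume U: "openin Y U"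
  let ?W = "{p \<in> topspace (prod_topology Z (sum_topology X I)). f p \<in> U}"
  show "openin (prod_topology Z (sum_topology X I)) ?W"
    unfolding openin_prod_topology_alt
  proof (intro allI impI)
    fix z s assume "(z, s) \<in> ?W"
    then obtain i x where s: "s = (i, x)" "i \<in> I" "x \<in> topspace (X i)" "z \<in> topspace Z"
      "f (z, (i, x)) \<in> U" by (cases s) auto
    define V where
      "V = {p \<in> topspace (prod_topology Z (X i)). (\<lambda>(z, x). f (z, (i, x))) p \<in> U}"
    have "openin (prod_topology Z (X i)) V"
      unfolding V_def using assms[OF s(2)] U by (rule openin_continuous_map_preimage)
    moreover have "(z, x) \<in> V" using s by (simp add: V_def)
    ultimately obtain A B where AB: "openin Z A" "openin (X i) B" "z \<in> A" "x \<in> B" "A \<times> B \<subseteq> V"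
      unfolding openin_prod_topology_alt by meson
    have "openin (sum_topology X I) (Pair i ` B)"
      using open_map_component_injection[OF s(2), of X] AB(2) unfolding open_map_def by blast
    moreover have "A \<times> Pair i ` B \<subseteq> ?W"
      using AB(5) s(2) by (auto simp: V_def)
    ultimately show "\<exists>A B. openin Z A \<and> openin (sum_topology X I) B \<and> z \<in> A \<and> s \<in> B \<and> A \<times> B \<subseteq> ?W"
      using AB s(1) by blast
  qed
qed

lemma continuous_map_scale_labels:
  "continuous_map (prod_topology (top_of_set {0..1}) (cube d)) (cube d) (\<lambda>(t, x). scale_labels d t x)"
  unfolding cube_def continuous_map_componentwise
proof (intro conjI ballI)
  have "(case p of (t, x) \<Rightarrow> scale_labels d t x) \<in> extensional {..<d}" for p
    by (simp add: scale_labels_def case_prod_beta)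
  then show "(\<lambda>(t, x). scale_labels d t x) ` topspace (prod_topology (top_of_set {0..1})
      (product_topology (\<lambda>_. top_of_set {0..1}) {..<d})) \<subseteq> extensional {..<d}"
    by blast
next
  fix k assume k: "k \<in> {..<d}"
  let ?P = "prod_topology (top_of_set {0..1}) (product_topology (\<lambda>_. top_of_set {0..1::real}) {..<d})"
  have "continuous_map ?P (top_of_set {0..1}) (\<lambda>p. snd p k)"
    using k continuous_map_compose[OF continuous_map_snd continuous_map_product_projection]
    by (force simp: comp_def)
  moreover have "continuous_map ?P (top_of_set {0..1::real}) fst"
    by (rule continuous_map_fst)
  ultimately have "continuous_map ?P euclideanreal (\<lambda>p. fst p * snd p k)"
    by (intro continuous_map_real_mult) (auto simp: continuous_map_in_subtopology)
  moreover have "fst p * snd p k \<in> {0..1}" if "p \<in> topspace ?P" for p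
  proof -
    from that have "fst p \<in> {0..1}" "snd p \<in> (\<Pi>\<^sub>E k\<in>{..<d}. {0..1})"
      by (simp_all only: topspace_prod_topology topspace_product_topology
          topspace_euclidean_subtopology mem_Times_iff o_def)
    with k have "fst p \<in> {0..1}" "snd p k \<in> {0..1}" using PiE_mem by blast+
    then show ?thesis by (simp add: mult_le_one)
  qed
  ultimately have "continuous_map ?P (top_of_set {0..1}) (\<lambda>p. fst p * snd p k)"
    unfolding continuous_map_in_subtopology by blast
  then show "continuous_map ?P (top_of_set {0..1}) (\<lambda>p. (case p of (t, x) \<Rightarrow> scale_labels d t x) k)"
    using k by (simp add: scale_labels_def case_prod_beta)
qed

lemma continuous_map_scale_cell:
  "continuous_map (prod_topology (top_of_set {0..1}) (cells n)) (cells n) (\<lambda>(t, a). scale_cell t a)"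
  unfolding cells_def
proof (rule continuous_map_prod_sum_topology)
  fix T assume T: "T \<in> binary_trees n"
  then have "H_cell T = cube (length (inner_edges T))"
    by (simp add: H_cell_def binary_trees_def num_inner_edges)
  then have "continuous_map (prod_topology (top_of_set {0..1}) (H_cell T)) (H_cell T)
      (\<lambda>(t, x). scale_labels (length (inner_edges T)) t x)"
    by (simp add: continuous_map_scale_labels)
  from continuous_map_compose[OF this continuous_map_component_injection[OF T, of H_cell]]
  show "continuous_map (prod_topology (top_of_set {0..1}) (H_cell T))
      (sum_topology H_cell (binary_trees n)) (\<lambda>(t, x). case (t, T, x) of (t, a) \<Rightarrow> scale_cell t a)"
    by (simp add: comp_def case_prod_unfold scale_cell_def)
qed

section \<open>The cells meet at the origin\<close>

text \<open>
  Reading a binary tree as a bracketed product, with corks as units, these are the rewriting steps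
  of the monoid axioms, applied at any place in the tree.
\<close>

inductive move :: "ptree \<Rightarrow> ptree \<Rightarrow> bool" where
  assoc: "move (Node [Node [a, b], c]) (Node [a, Node [b, c]])"
| unit_left: "move (Node [Node [], b]) b"
| unit_right: "move (Node [a, Node []]) a"
| left: "move a a' \<Longrightarrow> move (Node [a, b]) (Node [a', b])"
| right: "move b b' \<Longrightarrow> move (Node [a, b]) (Node [a, b'])"

lemma move_binary: "move S T \<Longrightarrow> is_binary S = is_binary T \<and> num_leaves S = num_leaves T"
  by (induction rule: move.induct) auto

lemma contract_Cons:
  assumes "e \<noteq> []" "i < length ts"
  shows "contract (Node ts) (i # e) = Node (ts[i := contract (ts ! i) e])"
  using assms by (simp add: contract_def Let_def)

lemma delete_edge_Cons:
  assumes "e \<noteq> []" "i < length ts"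
  shows "delete_edge (Node ts) (i # e) = Node (ts[i := delete_edge (ts ! i) e])"
  using assms by (simp add: delete_edge_def sibling_def)

text \<open>
  The combinatorial parts of the two gluing relations.  Edges are given by address and not by their
  number in the list of inner edges, because an address changes in a simple way when the tree becomes
  a child of a larger tree.
\<close>

definition contract_related :: "ptree \<Rightarrow> ptree \<Rightarrow> bool" where
  "contract_related S T \<longleftrightarrow> num_corks S = num_corks T \<and>
     (\<exists>e \<in> set (inner_edges S). \<exists>f \<in> set (inner_edges T).
        \<not> contains_cork S e \<and> \<not> contains_cork T f \<and> contract S e = contract T f)"

definition deletes_to :: "ptree \<Rightarrow> ptree \<Rightarrow> bool" where
  "deletes_to S T \<longleftrightarrow> (\<exists>e \<in> set (inner_edges S). contains_cork S e \<and> delete_edge S e = T)"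

lemma contract_related_child:
  assumes "contract_related a a'" "i < length ts" "ts ! i = a"
  shows "contract_related (Node ts) (Node (ts[i := a']))"
proof -
  from assms(1) obtain e f where ef: "num_corks a = num_corks a'"
    "e \<in> set (inner_edges a)" "f \<in> set (inner_edges a')"
    "\<not> contains_cork a e" "\<not> contains_cork a' f" "contract a e = contract a' f"
    unfolding contract_related_def by blast
  have "map num_corks (ts[i := a']) = map num_corks ts"
    using assms(2,3) ef(1) by (auto intro!: nth_equalityI simp: nth_list_update)
  then have corks: "num_corks (Node ts) = num_corks (Node (ts[i := a']))"
    using assms(2) by auto
  from ef assms(2,3) have "i # e \<in> set (inner_edges (Node ts))"
    "i # f \<in> set (inner_edges (Node (ts[i := a'])))"
    "\<not> contains_cork (Node ts) (i # e)" "\<not> contains_cork (Node (ts[i := a'])) (i # f)"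
    "contract (Node ts) (i # e) = contract (Node (ts[i := a'])) (i # f)"
    by (auto simp: set_inner_edges contains_cork_def contract_Cons)
  with corks show ?thesis unfolding contract_related_def by blast
qed

lemma deletes_to_child:
  assumes "deletes_to a a'" "i < length ts" "ts ! i = a"
  shows "deletes_to (Node ts) (Node (ts[i := a']))"
proof -
  from assms(1) obtain e where "e \<in> set (inner_edges a)" "contains_cork a e" "delete_edge a e = a'"
    unfolding deletes_to_def by blast
  with assms(2,3) show ?thesis unfolding deletes_to_def
    by (intro bexI[of _ "i # e"]) (auto simp: set_inner_edges contains_cork_def delete_edge_Cons)
qed

text \<open>
  Both sides of the associativity step contract to a vertex with the three children \<open>a\<close>, \<open>b\<close>, \<open>c\<close>;
  a unit step deletes the edge that ends in the cork.
\<close>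

lemma move_glue_cases: "move S T \<Longrightarrow> contract_related S T \<or> deletes_to S T"
proof (induction rule: move.induct)
  case (assoc a b c)
  have "contract_related (Node [Node [a, b], c]) (Node [a, Node [b, c]])"
    unfolding contract_related_def
    by (intro conjI bexI[of _ "[0]"] bexI[of _ "[1]"])
      (auto simp: set_inner_edges contains_cork_def contract_def)
  then show ?case ..
next
  case (unit_left b)
  have "deletes_to (Node [Node [], b]) b" unfolding deletes_to_def
    by (intro bexI[of _ "[0]"]) (auto simp: set_inner_edges contains_cork_def delete_edge_def sibling_def)
  then show ?case ..
next
  case (unit_right a)
  have "deletes_to (Node [a, Node []]) a" unfolding deletes_to_def
    by (intro bexI[of _ "[1]"]) (auto simp: set_inner_edges contains_cork_def delete_edge_def sibling_def)
  then show ?case ..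
next
  case (left a a' b)
  then show ?case
    using contract_related_child[of a a' 0 "[a, b]"] deletes_to_child[of a a' 0 "[a, b]"] by auto
next
  case (right b b' a)
  then show ?case
    using contract_related_child[of b b' 1 "[a, b]"] deletes_to_child[of b b' 1 "[a, b]"] by auto
qed

definition origin :: "ptree \<Rightarrow> ptree \<times> (nat \<Rightarrow> real)" where
  "origin T = (T, \<lambda>k\<in>{..<length (inner_edges T)}. 0)"

lemma scale_cell_0: "scale_cell 0 (T, x) = origin T"
  by (simp add: scale_cell_def scale_labels_def origin_def)

lemma origin_in_cells: "T \<in> binary_trees n \<Longrightarrow> origin T \<in> topspace (cells n)"
  by (auto simp: origin_def mem_cells topspace_cube)

text \<open>The relation between the trees glues some pair of points of their cells; scaling this pair by 0
  gives the two origins.\<close>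

lemma move_glue_origin:
  assumes "move S T" "S \<in> binary_trees n"
  shows "glue n (origin S) (origin T)"
proof -
  define z :: "nat \<Rightarrow> real" where "z = (\<lambda>k\<in>{..<2 * num_corks S + n - 3}. 0)"
  have z: "z \<in> topspace (cube (2 * num_corks S + n - 3))" by (auto simp: z_def topspace_cube)
  have T: "T \<in> binary_trees n" using assms move_binary by (auto simp: binary_trees_def)
  have "\<exists>x y. glue n (S, x) (T, y)"
    using move_glue_cases[OF assms(1)]
  proof
    assume "contract_related S T"
    then obtain i j where ij: "i < length (inner_edges S)" "j < length (inner_edges T)"
      "num_corks T = num_corks S"
      "\<not> contains_cork S (inner_edges S ! i)" "\<not> contains_cork T (inner_edges T ! j)"
      "contract S (inner_edges S ! i) = contract T (inner_edges T ! j)"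
      unfolding contract_related_def by (metis in_set_conv_nth)
    show ?thesis using glue.R1[OF assms(2) T refl ij(3,1,2,4,5,6) z] by blast
  next
    assume "deletes_to S T"
    then obtain i where i: "i < length (inner_edges S)" "contains_cork S (inner_edges S ! i)"
      "T = delete_edge S (inner_edges S ! i)"
      unfolding deletes_to_def by (metis in_set_conv_nth)
    show ?thesis using glue.R2[OF assms(2) refl i(1,2) z] i(3) by blast
  qed
  then obtain x y where "glue n (S, x) (T, y)" by blast
  from glue_scale_cell[OF this, of 0] show ?thesis by (simp add: scale_cell_0)
qed

lemma equivclp_move_origin:
  assumes "equivclp move S T" "S \<in> binary_trees n"
  shows "T \<in> binary_trees n \<and> (origin S, origin T) \<in> glue_equiv n"
proof -
  have "T \<in> binary_trees n \<and> equivclp (glue n) (origin S) (origin T)"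
    using assms(1)
  proof (induction rule: equivclp_induct)
    case base
    then show ?case using assms(2) by simp
  next
    case (step T U)
    then have U: "U \<in> binary_trees n" using move_binary by (auto simp: binary_trees_def)
    with step have "equivclp (glue n) (origin T) (origin U)"
      using move_glue_origin by (meson equivclp_sym r_into_equivclp)
    with step U show ?case by (meson equivclp_trans)
  qed
  then show ?thesis using assms(2) by (simp add: glue_equiv_def origin_in_cells)
qed

lemma equivclp_move_Node:
  assumes "equivclp move a a'" "equivclp move b b'"
  shows "equivclp move (Node [a, b]) (Node [a', b'])"
proof -
  have "equivclp move (Node [a, b]) (Node [a', b])"
    using assms(1) by (rule equivclp_map[where f = "\<lambda>a. Node [a, b]"]) (auto intro: move.left)
  moreover have "equivclp move (Node [a', b]) (Node [a', b'])"
    using assms(2) by (rule equivclp_map[where f = "\<lambda>b. Node [a', b]"]) (auto intro: move.right)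
  ultimately show ?thesis by (rule equivclp_trans)
qed

text \<open>The normal form is the right-bracketed product of \<open>n\<close> leaves that ends in one unit.  Keeping this
  cork treats all \<open>n\<close> alike, including \<open>n = 0\<close>, where a tree without corks does not exist.\<close>

fun comb :: "nat \<Rightarrow> ptree" where
  "comb 0 = Node []"
| "comb (Suc n) = Node [Leaf, comb n]"

lemma comb_in_binary_trees: "comb n \<in> binary_trees n"
  by (induction n) (auto simp: binary_trees_def)

lemma equivclp_move_comb_add: "equivclp move (Node [comb k, comb l]) (comb (k + l))"
proof (induction k)
  case 0
  then show ?case by (auto intro: move.unit_left)
next
  case (Suc k)
  have "equivclp move (Node [comb (Suc k), comb l]) (Node [Leaf, Node [comb k, comb l]])"
    by (auto intro: move.assoc)
  also have "equivclp move \<dots> (comb (Suc k + l))"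
    using Suc by (auto intro: equivclp_move_Node)
  finally (equivclp_trans) show ?case .
qed

lemma equivclp_move_comb: "is_binary T \<Longrightarrow> equivclp move T (comb (num_leaves T))"
proof (induction T)
  case Leaf
  have "move (Node [Leaf, Node []]) Leaf" by (rule move.unit_right)
  then show ?case by (auto intro: equivclp_sym)
next
  case (Node ts)
  from Node.prems consider "ts = []" | a b where "ts = [a, b]"
    by (auto simp: length_Suc_conv numeral_3_eq_3)
  then show ?case
  proof cases
    case 2
    with Node have "equivclp move (Node ts) (Node [comb (num_leaves a), comb (num_leaves b)])"
      by (auto intro: equivclp_move_Node)
    also have "equivclp move \<dots> (comb (num_leaves (Node ts)))"
      using equivclp_move_comb_add 2 by simp
    finally (equivclp_trans) show ?thesis .
  qed simp
qed

section \<open>Contractibility\<close>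

theorem corollary4p5:
  fixes n :: nat
  shows "topspace (unital_associahedron n) \<noteq> {} \<and> contractible_space (unital_associahedron n)"
proof -
  let ?I = "top_of_set {0..1::real}"
  let ?K = "unital_associahedron n"
  let ?q = "\<lambda>a. glue_equiv n `` {a}"
  let ?base = "?q (origin (comb n))"
  note equiv = equiv_glue_equiv[of n]
  have q: "quotient_map (cells n) ?K ?q"
    unfolding unital_associahedron_def by (rule quotient_map_quotient_topology[OF equiv])
  have K: "topspace ?K = ?q ` topspace (cells n)"
    using q by (simp add: quotient_map_def)
  have "locally_compact_space ?I"
    by (simp add: compact_imp_locally_compact_space compact_space_subtopology)
  then have Iq: "quotient_map (prod_topology ?I (cells n)) (prod_topology ?I ?K) (\<lambda>(t, a). (t, ?q a))"
    using q by (intro quotient_map_prod_right) (auto simp: Hausdorff_space_subtopology)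
  have cont: "continuous_map (prod_topology ?I (cells n)) ?K (\<lambda>(t, a). ?q (scale_cell t a))"
    using continuous_map_compose[OF continuous_map_scale_cell quotient_imp_continuous_map[OF q]]
    by (simp add: comp_def case_prod_unfold)
  \<comment> \<open>The scaling is constant on the fibres of the quotient map, so it descends to \<open>h\<close>.\<close>
  have resp: "?q (scale_cell t a) = ?q (scale_cell t b)"
    if "t \<in> {0..1}" "a \<in> topspace (cells n)" "b \<in> topspace (cells n)" "?q a = ?q b" for t a b
    using that eq_equiv_class_iff[OF equiv] glue_equiv_scale_cell equiv_class_eq[OF equiv] by metis
  obtain h where hom: "continuous_map (prod_topology ?I ?K) ?K h"
    "\<And>p. p \<in> topspace (prod_topology ?I (cells n)) \<Longrightarrow>
       h (case p of (t, a) \<Rightarrow> (t, ?q a)) = (case p of (t, a) \<Rightarrow> ?q (scale_cell t a))"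
  proof (rule quotient_map_lift_exists[OF Iq cont])
    fix p p' assume "p \<in> topspace (prod_topology ?I (cells n))" "p' \<in> topspace (prod_topology ?I (cells n))"
      "(case p of (t, a) \<Rightarrow> (t, ?q a)) = (case p' of (t, a) \<Rightarrow> (t, ?q a))"
    then show "(case p of (t, a) \<Rightarrow> ?q (scale_cell t a)) = (case p' of (t, a) \<Rightarrow> ?q (scale_cell t a))"
      using resp[of "fst p" "snd p" "snd p'"] by (cases p; cases p') auto
  qed (rule that)
  have h: "continuous_map (prod_topology ?I ?K) ?K h"
    "\<And>t a. t \<in> {0..1} \<Longrightarrow> a \<in> topspace (cells n) \<Longrightarrow> h (t, ?q a) = ?q (scale_cell t a)"
    using hom(1) hom(2)[of "(t, a)" for t a] by auto
  have h1: "h (1, C) = C" if "C \<in> topspace ?K" for C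
    using that h(2)[of 1] by (auto simp: K scale_cell_1)
  have h0: "h (0, C) = ?base" if C: "C \<in> topspace ?K" for C
  proof -
    from C obtain T x where a: "(T, x) \<in> topspace (cells n)" "C = ?q (T, x)" by (auto simp: K)
    then have T: "T \<in> binary_trees n" by (simp add: mem_cells)
    then have "equivclp move T (comb n)" using equivclp_move_comb by (auto simp: binary_trees_def)
    then have "?q (origin T) = ?base"
      using equivclp_move_origin[OF _ T] equiv_class_eq[OF equiv] by blast
    then show ?thesis using a h(2)[of 0] by (simp add: scale_cell_0)
  qed
  have "homotopic_with (\<lambda>_. True) ?K ?K (\<lambda>_. ?base) id"
    using h(1) h0 h1 by (subst homotopic_with) auto
  then have "contractible_space ?K"
    unfolding contractible_space_def using homotopic_with_sym by blast
  moreover have "topspace ?K \<noteq> {}"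
    using K origin_in_cells[OF comb_in_binary_trees] by blast
  ultimately show ?thesis by simp
qed

end
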